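(* Let $(a_\ell)_{\ell\in\mathbb{N}_0}$ and $(b_\ell)_{\ell\in\mathbb{N}_0}$ be sequences in $\mathbb{R}_{\ge0}$. With given constants $0<q<1$, $0<\delta<1$, and $C_1,C_2>0$, suppose that $$a_{\ell+1}\le q\,a_\ell+b_\ell,\qquad b_{\ell+N}\le C_1\,a_\ell,\qquad\text{and}\qquad\sum_{\ell'=\ell}^{\ell+N}b_{\ell'}^2\le C_2\,(N+1)^{1-\delta}\,a_\ell^2\qquad\text{for all }\ell,N\in\mathbb{N}_0.$$ Then $(a_\ell)_{\ell\in\mathbb{N}_0}$ is R-linearly convergent, i.e., there exist $C_{\mathrm{lin}}>0$ and $0<q_{\mathrm{lin}}<1$ with $$a_{\ell+n}\le C_{\mathrm{lin}}\,q_{\mathrm{lin}}^n\,a_\ell\qquad\text{for all }\ell,n\in\mathbb{N}_0.$$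
   Context: $\mathbb{N}_0=\{0,1,2,\dots\}$. *)

theory Defs
  imports Complex_Main
begin

end

theory Submission
  imports Defs
begin

text \<open>
  The three hypotheses are played off against each other as follows. Squaring the perturbed
  contraction by convexity gives \<open>a (l + 1)\<^sup>2 \<le> q * a l\<^sup>2 + b l\<^sup>2 / (1 - q)\<close>; summing this and
  absorbing the contracted sum on the left transfers the bound on the sums of \<open>b\<^sup>2\<close> to
  the sums of \<open>a\<^sup>2\<close> (lemma \<open>sum_squares_perturbed_contraction\<close>), so that \<open>N + 1\<close> consecutive
  squares starting at \<open>a l\<^sup>2\<close> add up to at most \<open>D * (N + 1) powr (1 - \<delta>) * a l\<^sup>2\<close>.
  The uniform bound on \<open>b\<close> makes \<open>a\<close> quasi-monotone, \<open>a (l + n) \<le> M * a l\<close>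
  (lemma \<open>quasi_monotone_perturbed_contraction\<close>), so the last of these summands is, up to the
  factor \<open>M\<^sup>2\<close>, at most their average:
  \<open>a (l + N)\<^sup>2 \<le> M\<^sup>2 * D * (N + 1) powr (-\<delta>) * a l\<^sup>2\<close>.

  Since the factor tends to zero, some fixed number of steps \<open>N\<close>, independent of \<open>l\<close>, at
  least halves \<open>a\<close>. Iterating this, with quasi-monotonicity controlling the remaining
  fewer than \<open>N\<close> steps, is R-linear convergence (lemma \<open>R_linear_if_multistep_contraction\<close>).
\<close>

text \<open>
  A bound \<open>M * a l\<close> survives one more step as soon as \<open>q * M + C \<le> M\<close>. The least such \<open>M\<close> is
  \<open>C / (1 - q)\<close>; the additional \<open>1\<close> covers the start \<open>n = 0\<close>.
\<close>

lemma quasi_monotone_perturbed_contraction: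
  fixes a b :: "nat \<Rightarrow> real"
  assumes "\<And>l. a l \<ge> 0" and "0 \<le> q" and "q < 1" and "0 \<le> C"
    and step: "\<And>l. a (l + 1) \<le> q * a l + b l"
    and bnd: "\<And>l N. b (l + N) \<le> C * a l"
  shows "a (l + n) \<le> (1 + C / (1 - q)) * a l"
proof (induction n)
  case 0
  have "1 \<le> 1 + C / (1 - q)" using assms(3,4) by simp
  from mult_right_mono[OF this assms(1)[of l]] show ?case by simp
next
  case (Suc n)
  define M where "M = 1 + C / (1 - q)"
  have "(1 - q) * M = (1 - q) + C"
    using assms(3) by (simp add: M_def distrib_left)
  then have M: "q * M + C \<le> M"
    using assms(3) by (simp add: algebra_simps)
  have "a (l + Suc n) \<le> q * a (l + n) + b (l + n)" using step[of "l + n"] by simp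
  also have "\<dots> \<le> q * (M * a l) + C * a l"
    using Suc.IH bnd \<open>0 \<le> q\<close> unfolding M_def by (intro add_mono mult_left_mono) auto
  also have "\<dots> = (q * M + C) * a l" by (simp add: algebra_simps)
  also have "\<dots> \<le> M * a l" using M assms(1) by (intro mult_right_mono)
  finally show ?case unfolding M_def .
qed

text \<open>
  Convexity of the square applied to \<open>q * x + (1 - q) * (y / (1 - q))\<close>. The factor \<open>q\<close> in front
  of \<open>x\<^sup>2\<close> stays below one, which is what makes absorption possible later.
\<close>

lemma square_convex_split:
  fixes q x y :: real
  assumes "0 \<le> q" and "q < 1"
  shows "(q * x + y)\<^sup>2 \<le> q * x\<^sup>2 + y\<^sup>2 / (1 - q)"
proof -
  have "q * x\<^sup>2 + y\<^sup>2 / (1 - q) - (q * x + y)\<^sup>2 = q * ((1 - q) * x - y)\<^sup>2 / (1 - q)"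
    using assms by (simp add: divide_simps power2_eq_square) (simp add: algebra_simps)
  also have "\<dots> \<ge> 0" using assms by simp
  finally show ?thesis by simp
qed

lemma sum_squares_perturbed_contraction:
  fixes a b :: "nat \<Rightarrow> real"
  assumes "\<And>l. a l \<ge> 0" and "0 \<le> q" and "q < 1"
    and step: "\<And>l. a (l + 1) \<le> q * a l + b l"
  shows "(1 - q) * (\<Sum>k=l..l+N. (a k)\<^sup>2) \<le> (a l)\<^sup>2 + (\<Sum>k=l..l+N. (b k)\<^sup>2) / (1 - q)"
proof -
  \<comment> \<open>The surplus term \<open>a (l + N + 1)\<^sup>2\<close> on the left makes the estimate inductive.\<close>
  have "(1 - q) * (\<Sum>k=l..l+N. (a k)\<^sup>2) + (a (l + N + 1))\<^sup>2
      \<le> (a l)\<^sup>2 + (\<Sum>k=l..l+N. (b k)\<^sup>2) / (1 - q)" for N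
  proof -
    have sq: "(a (k + 1))\<^sup>2 \<le> q * (a k)\<^sup>2 + (b k)\<^sup>2 / (1 - q)" for k
      using power_mono[OF step assms(1), of k 2] square_convex_split[OF assms(2,3)]
      by (rule order_trans)
    show ?thesis
    proof (induction N)
      case 0
      then show ?case using sq[of l] by (simp add: algebra_simps)
    next
      case (Suc N)
      then show ?case using sq[of "l + N + 1"]
        by (simp add: algebra_simps add_divide_distrib)
    qed
  qed
  from this[of N] show ?thesis using zero_le_power2[of "a (l + N + 1)"] by linarith
qed

text \<open>
  The rate is the \<open>p\<close>-th root \<open>r\<close> of the \<open>p\<close>-step contraction factor \<open>\<theta>\<close>. With \<open>n = p * m + s\<close>
  and \<open>s < p\<close>, the \<open>m\<close> complete blocks contribute \<open>\<theta> ^ m = r ^ n / r ^ s \<le> r ^ n / \<theta>\<close>; this is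
  the origin of the constant \<open>M / \<theta>\<close>.
\<close>

lemma R_linear_if_multistep_contraction:
  fixes a :: "nat \<Rightarrow> real"
  assumes nonneg: "\<And>l. a l \<ge> 0" and "0 < M" and "0 < \<theta>" and "\<theta> < 1" and "0 < p"
    and mono: "\<And>l n. a (l + n) \<le> M * a l"
    and contr: "\<And>l. a (l + p) \<le> \<theta> * a l"
  shows "\<exists>C r. C > 0 \<and> 0 < r \<and> r < 1 \<and> (\<forall>l n. a (l + n) \<le> C * r ^ n * a l)"
proof -
  define r where "r = root p \<theta>"
  have r: "0 < r" "r < 1" and rp: "r ^ p = \<theta>"
    using assms by (auto simp: r_def real_root_gt_0_iff real_root_lt_1_iff real_root_pow_pos)
  have blocks: "a (l + p * m) \<le> \<theta> ^ m * a l" for l m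
  proof (induction m)
    case (Suc m)
    have "a (l + p * Suc m) \<le> \<theta> * a (l + p * m)"
      using contr[of "l + p * m"] by (simp add: algebra_simps)
    also have "\<dots> \<le> \<theta> * (\<theta> ^ m * a l)" using Suc \<open>0 < \<theta>\<close> by simp
    finally show ?case by (simp add: mult.assoc)
  qed simp
  have "a (l + n) \<le> M / \<theta> * r ^ n * a l" for l n
  proof -
    define m where "m = n div p"
    define s where "s = n mod p"
    have n: "n = p * m + s" by (simp add: m_def s_def)
    have "s \<le> p" using \<open>0 < p\<close> by (simp add: s_def less_imp_le)
    then have "\<theta> \<le> r ^ s"
      using r power_decreasing[of s p r] by (simp add: rp)
    then have "\<theta> * \<theta> ^ m \<le> r ^ s * \<theta> ^ m"
      using \<open>0 < \<theta>\<close> by (intro mult_right_mono) auto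
    also have "\<dots> = r ^ n" by (simp add: n power_add power_mult rp)
    finally have rate: "\<theta> ^ m \<le> r ^ n / \<theta>" using \<open>0 < \<theta>\<close> by (simp add: field_simps)
    have "a (l + n) \<le> M * a (l + p * m)"
      using mono[of "l + p * m" s] by (simp add: n add.assoc)
    also have "\<dots> \<le> M * (\<theta> ^ m * a l)" using blocks \<open>0 < M\<close> by simp
    also have "\<dots> \<le> M * (r ^ n / \<theta> * a l)"
      using rate nonneg \<open>0 < M\<close> by (intro mult_left_mono mult_right_mono) auto
    finally show ?thesis by simp
  qed
  then show ?thesis using r \<open>0 < M\<close> \<open>0 < \<theta>\<close>
    by (intro exI[of _ "M / \<theta>"] exI[of _ r]) auto
qed

theorem lemma8:
  fixes a b :: "nat \<Rightarrow> real" and q \<delta> C\<^sub>1 C\<^sub>2 :: real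
  assumes "\<And>l. a l \<ge> 0" and "\<And>l. b l \<ge> 0"
    and "0 < q" and "q < 1"
    and "0 < \<delta>" and "\<delta> < 1"
    and "C\<^sub>1 > 0" and "C\<^sub>2 > 0"
    and "\<And>l. a (l + 1) \<le> q * a l + b l"
    and "\<And>l N. b (l + N) \<le> C\<^sub>1 * a l"
    and "\<And>l N. (\<Sum>k=l..l+N. (b k)\<^sup>2) \<le> C\<^sub>2 * real (N + 1) powr (1 - \<delta>) * (a l)\<^sup>2"
  shows "\<exists>C_lin q_lin :: real. C_lin > 0 \<and> 0 < q_lin \<and> q_lin < 1 \<and>
           (\<forall>l n. a (l + n) \<le> C_lin * q_lin ^ n * a l)"
proof -
  define M where "M = 1 + C\<^sub>1 / (1 - q)"
  define D where "D = (1 + C\<^sub>2 / (1 - q)) / (1 - q)"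
  have "0 < M" using assms(4,7) by (simp add: M_def add_pos_pos)
  have mono: "a (l + n) \<le> M * a l" for l n
    unfolding M_def
    using quasi_monotone_perturbed_contraction[of a q "C\<^sub>1" b] assms(1,3,4,7,9,10) by simp
  have sum: "(\<Sum>k=l..l+N. (a k)\<^sup>2) \<le> D * real (N + 1) powr (1 - \<delta>) * (a l)\<^sup>2" for l N
  proof -
    define P where "P = real (N + 1) powr (1 - \<delta>)"
    have "1 \<le> P" using assms(6) by (simp add: P_def ge_one_powr_ge_zero)
    have "(1 - q) * (\<Sum>k=l..l+N. (a k)\<^sup>2) \<le> (a l)\<^sup>2 + (\<Sum>k=l..l+N. (b k)\<^sup>2) / (1 - q)"
      using sum_squares_perturbed_contraction[of a q b] assms(1,3,4,9) by simp
    also have "\<dots> \<le> P * (a l)\<^sup>2 + C\<^sub>2 * P * (a l)\<^sup>2 / (1 - q)"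
      using assms(4) assms(11)[of l N] mult_right_mono[OF \<open>1 \<le> P\<close> zero_le_power2[of "a l"]]
      by (intro add_mono divide_right_mono) (auto simp: P_def)
    also have "\<dots> = (1 + C\<^sub>2 / (1 - q)) * (P * (a l)\<^sup>2)" by (simp add: algebra_simps)
    also have "\<dots> = (1 - q) * (D * P * (a l)\<^sup>2)" using assms(4) by (simp add: D_def)
    finally show ?thesis using assms(4) by (simp add: P_def)
  qed
  have decay: "(a (l + N))\<^sup>2 \<le> M\<^sup>2 * D * real (N + 1) powr (-\<delta>) * (a l)\<^sup>2" for l N
  proof -
    have "(a (l + N))\<^sup>2 \<le> M\<^sup>2 * (a k)\<^sup>2" if "k \<in> {l..l+N}" for k
      using power_mono[OF mono[of k "l + N - k"] assms(1), of 2] that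
      by (simp add: power_mult_distrib)
    then have "(\<Sum>k=l..l+N. (a (l + N))\<^sup>2) \<le> (\<Sum>k=l..l+N. M\<^sup>2 * (a k)\<^sup>2)"
      by (rule sum_mono)
    then have "real (N + 1) * (a (l + N))\<^sup>2 \<le> M\<^sup>2 * (\<Sum>k=l..l+N. (a k)\<^sup>2)"
      by (simp add: sum_distrib_left)
    also have "\<dots> \<le> M\<^sup>2 * (D * real (N + 1) powr (1 - \<delta>) * (a l)\<^sup>2)"
      using sum by (intro mult_left_mono) auto
    also have "real (N + 1) powr (1 - \<delta>) = real (N + 1) * real (N + 1) powr (-\<delta>)"
      using powr_add[of "real (N + 1)" 1 "-\<delta>"] by simp
    finally have "real (N + 1) * (a (l + N))\<^sup>2
        \<le> real (N + 1) * (M\<^sup>2 * D * real (N + 1) powr (-\<delta>) * (a l)\<^sup>2)"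
      by (simp only: ac_simps)
    then show ?thesis by (rule mult_left_le_imp_le) simp
  qed
  have "(\<lambda>N. M\<^sup>2 * D * real (Suc N) powr (-\<delta>)) \<longlonglongrightarrow> M\<^sup>2 * D * 0"
    using assms(5) LIMSEQ_Suc[OF tendsto_neg_powr[OF _ filterlim_real_sequentially, of "-\<delta>"]]
    by (intro tendsto_mult_left) simp
  then have "\<forall>\<^sub>F N in sequentially. M\<^sup>2 * D * real (Suc N) powr (-\<delta>) < (1 / 2)\<^sup>2"
    by (rule order_tendstoD) (simp add: power2_eq_square)
  \<comment> \<open>A block must have positive length, hence the additional requirement on \<open>p\<close>.\<close>
  then obtain p where p: "0 < p" "M\<^sup>2 * D * real (p + 1) powr (-\<delta>) < (1 / 2)\<^sup>2"
    using eventually_happens'[OF sequentially_bot eventually_conj[OF eventually_gt_at_top[of 0]]]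
    by (metis (no_types, lifting) Suc_eq_plus1)
  have "a (l + p) \<le> 1 / 2 * a l" for l
  proof (rule power2_le_imp_le)
    have "(a (l + p))\<^sup>2 \<le> (1 / 2)\<^sup>2 * (a l)\<^sup>2"
      using decay[of l p] mult_right_mono[OF less_imp_le[OF p(2)] zero_le_power2[of "a l"]]
      by (rule order_trans)
    then show "(a (l + p))\<^sup>2 \<le> (1 / 2 * a l)\<^sup>2" by (simp only: power_mult_distrib)
  qed (simp add: assms(1))
  then show ?thesis
    using R_linear_if_multistep_contraction[of a M "1 / 2" p] assms(1) \<open>0 < M\<close> p(1) mono by simp
qed

end
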